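(* Let $m,n$ be natural numbers with $1<m<n$, let $X=\{1<2<\cdots<n\}$ and let $Y=\{a_1<a_2<\cdots<a_m\}\subseteq X$. Then: 1. $\operatorname{rank}(\mathcal{OP}(X,Y):\mathcal{O}(X,Y))=\binom{n-1}{m}$ if $1\notin Y$ or $n\notin Y$; 2. $\operatorname{rank}(\mathcal{OP}(X,Y):\mathcal{O}(X,Y))=1+\binom{n-1}{m}$ if $\{1,n\}\subseteq Y$.
   Context: $\mathcal{T}(X)$ is the semigroup of all maps $X\to X$, written on the right and composed left to right. $\mathcal{T}(X,Y)=\{\alpha\in\mathcal{T}(X): X\alpha\subseteq Y\}$. A map $\alpha\in\mathcal{T}(X)$ is order-preserving if $x\le y$ implies $x\alpha\le y\alpha$. It is orientation-preserving if there are subsets $X_1,X_2\subseteq X$ with $X=X_1\cup X_2$, $X_1\neq\emptyset$ ($X_2$ may be empty), $X_1<X_2$ (i.e. $x_1<x_2$ for all $x_1\in X_1$, $x_2\in X_2$), such that $x\alpha\le y\alpha$ whenever either $(x,y)\in X_1^2\cup X_2^2$ with $x\le y$, or $(x,y)\in X_2\times X_1$. $\mathcal{O}(X,Y)$ and $\mathcal{OP}(X,Y)$ denote the semigroups of all order-preserving, respectively orientation-preserving, transformations in $\mathcal{T}(X,Y)$. For a semigroup $S$ and $A\subseteq S$, the relative rank $\operatorname{rank}(S:A)$ is the minimal cardinality of a set $B\subseteq S$ such that $A\cup B$ generates $S$ (as a semigroup). *)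

theory Defs
  imports Complex_Main "HOL-Library.FuncSet" "HOL-Library.Extended_Nat"
begin

text \<open>Maps on a set X are represented by extensional functions (undefined outside X),
  so that equality of functions is equality of maps.\<close>

definition full_trans :: "'a set \<Rightarrow> ('a \<Rightarrow> 'a) set" where
  "full_trans X = X \<rightarrow>\<^sub>E X"

definition trans_into :: "'a set \<Rightarrow> 'a set \<Rightarrow> ('a \<Rightarrow> 'a) set" where
  "trans_into X Y = {\<alpha> \<in> full_trans X. \<alpha> ` X \<subseteq> Y}"

text \<open>Maps act on the right: the product of \<open>\<alpha>\<close> and \<open>\<beta>\<close> applies \<open>\<alpha>\<close> first.\<close>

definition rcomp :: "'a set \<Rightarrow> ('a \<Rightarrow> 'a) \<Rightarrow> ('a \<Rightarrow> 'a) \<Rightarrow> 'a \<Rightarrow> 'a" where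
  "rcomp X \<alpha> \<beta> = compose X \<beta> \<alpha>"

definition orientation_preserving :: "'a::linorder set \<Rightarrow> ('a \<Rightarrow> 'a) \<Rightarrow> bool" where
  "orientation_preserving X \<alpha> \<longleftrightarrow>
     (\<exists>X1 X2. X1 \<subseteq> X \<and> X2 \<subseteq> X \<and> X = X1 \<union> X2 \<and> X1 \<noteq> {} \<and>
        (\<forall>x1\<in>X1. \<forall>x2\<in>X2. x1 < x2) \<and>
        (\<forall>x y. ((x, y) \<in> X1 \<times> X1 \<union> X2 \<times> X2 \<and> x \<le> y) \<or> (x, y) \<in> X2 \<times> X1
           \<longrightarrow> \<alpha> x \<le> \<alpha> y))"

definition order_pres_trans :: "'a::linorder set \<Rightarrow> 'a set \<Rightarrow> ('a \<Rightarrow> 'a) set" where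
  "order_pres_trans X Y = {\<alpha> \<in> trans_into X Y. mono_on X \<alpha>}"

definition orient_pres_trans :: "'a::linorder set \<Rightarrow> 'a set \<Rightarrow> ('a \<Rightarrow> 'a) set" where
  "orient_pres_trans X Y = {\<alpha> \<in> trans_into X Y. orientation_preserving X \<alpha>}"

text \<open>The set of all finite nonempty products of elements of G.\<close>

inductive_set semigroup_gen :: "('s \<Rightarrow> 's \<Rightarrow> 's) \<Rightarrow> 's set \<Rightarrow> 's set"
  for mult :: "'s \<Rightarrow> 's \<Rightarrow> 's" and G :: "'s set" where
  base: "g \<in> G \<Longrightarrow> g \<in> semigroup_gen mult G"
| mult: "\<lbrakk>a \<in> semigroup_gen mult G; b \<in> semigroup_gen mult G\<rbrakk>
         \<Longrightarrow> mult a b \<in> semigroup_gen mult G"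

text \<open>The infimum in \<open>enat\<close> is a minimum unless no finite B works, in which case it is
  \<open>\<infinity>\<close>; infinite cardinalities are not distinguished.\<close>

definition relative_rank :: "('s \<Rightarrow> 's \<Rightarrow> 's) \<Rightarrow> 's set \<Rightarrow> 's set \<Rightarrow> enat" where
  "relative_rank mult S A =
     (INF B \<in> {B. B \<subseteq> S \<and> finite B \<and> semigroup_gen mult (A \<union> B) = S}. enat (card B))"

end

theory Submission
  imports Defs
begin

text \<open>Write \<open>Y\<close> as \<open>a 0 < \<dots> < a (m - 1)\<close> and place \<open>1, \<dots>, n\<close> on a circle. An orientation-preserving
map of maximal rank \<open>m\<close> cuts the circle at \<open>m\<close> places into \<open>m\<close> arcs and sends the arcs, in cyclic
order, to the points of \<open>Y\<close>; it is determined by the set \<open>C\<close> of cuts, where \<open>c \<in> C\<close> stands for the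
gap between \<open>c\<close> and its cyclic successor, and by a cyclic shift \<open>s\<close>. These are the maps
\<open>arc_map C s\<close>. A cut at \<open>n\<close> separates \<open>n\<close> from \<open>1\<close>. The order-preserving maps of rank \<open>m\<close> are among
those with \<open>n \<in> C\<close>, and there are \<open>(n - 1) choose m\<close> sets \<open>C\<close> of size \<open>m\<close> that avoid \<open>n\<close>.

Lower bound. Composing on the right can only glue points together, so the cuts of a product are cuts
of its first factor (lemma \<open>cuts_semigroup_gen\<close>). An orientation-preserving map into \<open>Y\<close> has at most \<open>m\<close> cuts below \<open>n\<close>, and
fewer than \<open>m\<close> if it is order-preserving. Hence for every \<open>m\<close>-set \<open>C\<close> that avoids \<open>n\<close> some added
generator has exactly the cuts \<open>C\<close> (lemma \<open>cut_sets_covered\<close>). Such a generator identifies \<open>1\<close> and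
\<open>n\<close>. If \<open>1\<close> and \<open>n\<close> both lie in \<open>Y\<close>, it is therefore not injective on \<open>Y\<close> and can occur in a product
of rank \<open>m\<close> only as the first factor, where it forces the product to identify \<open>1\<close> and \<open>n\<close> too.
So order-preserving maps and such generators yield no map of rank \<open>m\<close> that separates \<open>1\<close> from \<open>n\<close>
without being order-preserving, and one more generator is needed (lemma \<open>exists_generator_few_cuts\<close>).

Upper bound. Every orientation-preserving map into \<open>Y\<close> is some \<open>arc_map C s\<close> followed by an
order-preserving map (lemma \<open>OP_factor\<close>). Once a generator rotates \<open>Y\<close> by one step, its powers turn
\<open>arc_map C s\<close> into all \<open>arc_map C s'\<close>, so one shift for each \<open>C\<close> suffices, and for \<open>n \<in> C\<close> there is an
order-preserving one (lemma \<open>gens_generate\<close>). A map that rotates \<open>Y\<close> is found with cuts \<open>Y\<close>; if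
\<open>n \<in> Y\<close> but \<open>1 \<notin> Y\<close>, taking the predecessors of the points of \<open>Y\<close> as cuts avoids a cut at \<open>n\<close>. So the
rotation costs no generator beyond those already counted, unless both \<open>1\<close> and \<open>n\<close> lie in \<open>Y\<close>.\<close>

section \<open>Orientation-preserving maps as monotone maps of a rotated chain\<close>

text \<open>The position of \<open>x\<close> in the chain \<open>p + 1 < \<dots> < n < 1 < \<dots> < p\<close>, up to an additive constant.\<close>

definition pos :: "nat \<Rightarrow> nat \<Rightarrow> nat \<Rightarrow> nat" where
  "pos n p x = (if p < x then x else x + n)"

definition turned_mono :: "nat \<Rightarrow> nat \<Rightarrow> (nat \<Rightarrow> nat) \<Rightarrow> bool" where
  "turned_mono n p f \<longleftrightarrow> (\<forall>x\<in>{1..n}. \<forall>y\<in>{1..n}. pos n p x \<le> pos n p y \<longrightarrow> f x \<le> f y)"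

definition cyc_succ :: "nat \<Rightarrow> nat \<Rightarrow> nat" where
  "cyc_succ n x = (if x = n then 1 else Suc x)"

lemma turned_monoD:
  "turned_mono n p f \<Longrightarrow> x \<in> {1..n} \<Longrightarrow> y \<in> {1..n} \<Longrightarrow> pos n p x \<le> pos n p y \<Longrightarrow> f x \<le> f y"
  by (auto simp: turned_mono_def)

lemma pos_inj:
  "x \<in> {1..n} \<Longrightarrow> y \<in> {1..n} \<Longrightarrow> pos n p x = pos n p y \<Longrightarrow> x = y"
  by (auto simp: pos_def split: if_splits)

lemma pos_le_last: "p \<in> {1..n} \<Longrightarrow> x \<in> {1..n} \<Longrightarrow> pos n p x \<le> pos n p p"
  by (auto simp: pos_def)

lemma cyc_succ_in: "x \<in> {1..n} \<Longrightarrow> cyc_succ n x \<in> {1..n}"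
  by (auto simp: cyc_succ_def)

lemma pos_cyc_succ:
  "p \<in> {1..n} \<Longrightarrow> x \<in> {1..n} \<Longrightarrow> x \<noteq> p \<Longrightarrow> pos n p (cyc_succ n x) = Suc (pos n p x)"
  by (auto simp: pos_def cyc_succ_def)

lemma turned_mono_last: "turned_mono n n f \<longleftrightarrow> mono_on {1..n} f"
  by (auto simp: turned_mono_def pos_def mono_on_def)

text \<open>A splitting \<open>X\<^sub>1 < X\<^sub>2\<close> is determined by \<open>p = Max X\<^sub>1\<close>, and the three monotonicity conditions say
together that the map is monotone once \<open>X\<^sub>2\<close> is moved in front of \<open>X\<^sub>1\<close>. An empty \<open>X\<^sub>2\<close> corresponds
to \<open>p = n\<close>.\<close>

lemma orientation_preserving_iff_turned_mono:
  assumes "1 \<le> n"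
  shows "orientation_preserving {1..n} f \<longleftrightarrow> (\<exists>p\<in>{1..n}. turned_mono n p f)"
proof
  assume "orientation_preserving {1..n} f"
  then obtain X1 X2 where sub: "X1 \<subseteq> {1..n}" "X2 \<subseteq> {1..n}" and un: "{1..n} = X1 \<union> X2"
    and ne: "X1 \<noteq> {}" and less: "\<forall>x1\<in>X1. \<forall>x2\<in>X2. x1 < x2"
    and mon: "\<forall>x y. ((x, y) \<in> X1 \<times> X1 \<union> X2 \<times> X2 \<and> x \<le> y) \<or> (x, y) \<in> X2 \<times> X1 \<longrightarrow> f x \<le> f y"
    unfolding orientation_preserving_def by (elim exE conjE) (rule that)
  have fin: "finite X1" using sub(1) finite_subset by blast
  define p where "p = Max X1"
  have p: "p \<in> X1" unfolding p_def using fin ne by simp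
  have mem: "x \<in> X1 \<longleftrightarrow> x \<le> p" "x \<in> X2 \<longleftrightarrow> p < x" if "x \<in> {1..n}" for x
  proof -
    have le: "x \<le> p" if "x \<in> X1" using that fin by (simp add: p_def)
    have gt: "p < x" if "x \<in> X2" using that p less by blast
    have "x \<in> X1 \<or> x \<in> X2" using that un by blast
    then show "x \<in> X1 \<longleftrightarrow> x \<le> p" "x \<in> X2 \<longleftrightarrow> p < x"
      using le gt by (meson leD not_le)+
  qed
  have "turned_mono n p f"
    unfolding turned_mono_def
  proof (intro ballI impI)
    fix x y assume "x \<in> {1..n}" "y \<in> {1..n}" "pos n p x \<le> pos n p y"
    then show "f x \<le> f y"
      by (intro mon[rule_format]) (auto simp: mem pos_def split: if_splits)
  qed
  then show "\<exists>p\<in>{1..n}. turned_mono n p f" using p sub by blast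
next
  assume "\<exists>p\<in>{1..n}. turned_mono n p f"
  then obtain p where p: "p \<in> {1..n}" "turned_mono n p f" by blast
  show "orientation_preserving {1..n} f"
    unfolding orientation_preserving_def
  proof (intro exI conjI)
    show "{1..n} = {1..p} \<union> {Suc p..n}" using p by auto
    show "\<forall>x y. (x, y) \<in> {1..p} \<times> {1..p} \<union> {Suc p..n} \<times> {Suc p..n} \<and> x \<le> y \<or>
          (x, y) \<in> {Suc p..n} \<times> {1..p} \<longrightarrow> f x \<le> f y"
      using p by (auto intro!: turned_monoD[OF p(2)] simp: pos_def)
  qed (use p in auto)
qed

text \<open>Restarting the rotated chain after \<open>r\<close> interchanges the part up to \<open>r\<close> with the part beyond \<open>r\<close> and
keeps the order inside each part.\<close>

lemma pos_change_start:
  assumes "p \<in> {1..n}" "r \<in> {1..n}" "x \<in> {1..n}" "y \<in> {1..n}" "pos n r x \<le> pos n r y"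
  shows "(pos n p x \<le> pos n p y \<and> (pos n p x \<le> pos n p r \<longleftrightarrow> pos n p y \<le> pos n p r))
       \<or> (pos n p r < pos n p x \<and> pos n p y \<le> pos n p r)"
  using assms by (auto simp: pos_def split: if_splits)

text \<open>In the chain that starts after \<open>p\<close>, the points with \<open>f x \<le> q\<close> form an initial segment, on which \<open>g \<circ> f\<close>
increases, and it also increases on the rest, with smaller values there. So the composite is
monotone in the chain that starts right after this segment.\<close>

lemma turned_mono_comp:
  assumes p: "p \<in> {1..n}" and q: "q \<in> {1..n}"
    and f: "turned_mono n p f" and g: "turned_mono n q g"
    and im: "f ` {1..n} \<subseteq> {1..n}"
  shows "\<exists>r\<in>{1..n}. turned_mono n r (\<lambda>x. g (f x))"
proof -
  define P where "P = {x\<in>{1..n}. f x \<le> q}"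
  have fin: "finite P" by (simp add: P_def)
  show ?thesis
  proof (cases "P = {}")
    case True
    \<comment> \<open>The initial segment is empty, so the starting point need not be changed.\<close>
    then have gt: "q < f x" if "x \<in> {1..n}" for x
      using that by (auto simp: P_def)
    have "turned_mono n p (\<lambda>x. g (f x))"
      unfolding turned_mono_def
    proof (intro ballI impI)
      fix x y assume xy: "x \<in> {1..n}" "y \<in> {1..n}" "pos n p x \<le> pos n p y"
      then have "f x \<le> f y" using turned_monoD[OF f] by blast
      then show "g (f x) \<le> g (f y)"
        using turned_monoD[OF g, of "f x" "f y"] gt[of x] gt[of y] xy im
        by (auto simp: pos_def image_subset_iff)
    qed
    then show ?thesis using p by blast
  next
    case False
    then have "Max (pos n p ` P) \<in> pos n p ` P" using fin by simp
    then obtain r where r: "r \<in> P" and max: "pos n p r = Max (pos n p ` P)" by force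
    have rX: "r \<in> {1..n}" and rq: "f r \<le> q" using r by (auto simp: P_def)
    have mem: "f x \<le> q \<longleftrightarrow> pos n p x \<le> pos n p r" if "x \<in> {1..n}" for x
    proof
      assume "f x \<le> q"
      then have "x \<in> P" using that by (simp add: P_def)
      then show "pos n p x \<le> pos n p r" using fin max by simp
    next
      assume "pos n p x \<le> pos n p r"
      then have "f x \<le> f r" using turned_monoD[OF f that rX] by blast
      then show "f x \<le> q" using rq by simp
    qed
    have "turned_mono n r (\<lambda>x. g (f x))"
      unfolding turned_mono_def
    proof (intro ballI impI)
      fix x y assume xy: "x \<in> {1..n}" "y \<in> {1..n}" "pos n r x \<le> pos n r y"
      have fxy: "f x \<in> {1..n}" "f y \<in> {1..n}" using xy(1,2) im by blast+
      from pos_change_start[OF p rX xy]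
      have "(f x \<le> f y \<and> (f x \<le> q \<longleftrightarrow> f y \<le> q)) \<or> (q < f x \<and> f y \<le> q)"
        using turned_monoD[OF f xy(1,2)] mem[OF xy(1)] mem[OF xy(2)] by linarith
      then have "pos n q (f x) \<le> pos n q (f y)" using fxy by (auto simp: pos_def)
      then show "g (f x) \<le> g (f y)" using turned_monoD[OF g] fxy by blast
    qed
    then show ?thesis using rX by blast
  qed
qed

text \<open>The gap after \<open>p\<close> is included even when \<open>f\<close> is constant: an arc map can increase along the chain that
starts there only if it is cut there.\<close>

definition cyc_cuts :: "nat \<Rightarrow> nat \<Rightarrow> (nat \<Rightarrow> nat) \<Rightarrow> nat set" where
  "cyc_cuts n p f = {x\<in>{1..n}. x = p \<or> f x \<noteq> f (cyc_succ n x)}"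

text \<open>Along the rotated chain the value strictly increases just after every cut other than the last
point \<open>p\<close>, so different cuts have different values. This bounds the number of cuts by the rank.\<close>

lemma inj_on_cyc_cuts:
  assumes p: "p \<in> {1..n}" and f: "turned_mono n p f"
  shows "inj_on f (cyc_cuts n p f)"
proof -
  have "f x \<noteq> f y" if x: "x \<in> cyc_cuts n p f" and y: "y \<in> cyc_cuts n p f"
    and less: "pos n p x < pos n p y" for x y
  proof -
    have xy: "x \<in> {1..n}" "y \<in> {1..n}" using x y by (auto simp: cyc_cuts_def)
    have "x \<noteq> p" using pos_le_last[OF p xy(2)] less by auto
    then have ne: "f x \<noteq> f (cyc_succ n x)" and s: "pos n p (cyc_succ n x) = Suc (pos n p x)"
      using x pos_cyc_succ[OF p xy(1)] by (auto simp: cyc_cuts_def)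
    have "f x \<le> f (cyc_succ n x)" "f (cyc_succ n x) \<le> f y"
      using s less by (auto intro!: turned_monoD[OF f] cyc_succ_in xy simp del: atLeastAtMost_iff)
    then show ?thesis using ne by linarith
  qed
  then show ?thesis
    unfolding inj_on_def
    by (metis (no_types, lifting) cyc_cuts_def linorder_neqE_nat mem_Collect_eq pos_inj)
qed

text \<open>The last point after \<open>z\<close> in the rotated chain whose value is still below \<open>f x\<close> is a cut.\<close>

lemma cut_between:
  assumes p: "p \<in> {1..n}" and f: "turned_mono n p f"
    and zx: "z \<in> {1..n}" "x \<in> {1..n}" and less: "f z < f x"
  shows "\<exists>c\<in>cyc_cuts n p f. pos n p z \<le> pos n p c \<and> pos n p c < pos n p x"
proof -
  define W where "W = {w\<in>{1..n}. pos n p z \<le> pos n p w \<and> f w < f x}"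
  have fin: "finite W" by (simp add: W_def)
  have "z \<in> W" using zx less by (simp add: W_def)
  then have "Max (pos n p ` W) \<in> pos n p ` W" using fin by (intro Max_in) auto
  then obtain w where w: "w \<in> W" and max: "pos n p w = Max (pos n p ` W)" by force
  have wX: "w \<in> {1..n}" and zw: "pos n p z \<le> pos n p w" and wx: "f w < f x"
    using w by (auto simp: W_def)
  have lt: "pos n p w < pos n p x"
    using turned_monoD[OF f zx(2) wX] wx by linarith
  then have "w \<noteq> p" using pos_le_last[OF p zx(2)] by auto
  then have s: "pos n p (cyc_succ n w) = Suc (pos n p w)" using pos_cyc_succ[OF p wX] by blast
  have "cyc_succ n w \<notin> W"
  proof
    assume "cyc_succ n w \<in> W"
    then have "pos n p (cyc_succ n w) \<le> pos n p w" using fin max by simp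
    then show False using s by simp
  qed
  then have "\<not> f (cyc_succ n w) < f x" using s zw cyc_succ_in[OF wX] by (simp add: W_def)
  then have "w \<in> cyc_cuts n p f" using wx wX by (auto simp: cyc_cuts_def)
  then show ?thesis using zw lt by blast
qed

section \<open>Cuts as an obstruction\<close>

text \<open>The gap between \<open>n\<close> and \<open>1\<close> is left out: whether a map with the largest possible number of such cuts
identifies \<open>1\<close> and \<open>n\<close> is then a conclusion, and the set is defined without reference to a
starting point of the chain.\<close>

definition cuts :: "nat \<Rightarrow> (nat \<Rightarrow> nat) \<Rightarrow> nat set" where
  "cuts n f = {x\<in>{1..<n}. f x \<noteq> f (Suc x)}"

lemma finite_cuts: "finite (cuts n f)"
  by (simp add: cuts_def)

lemma cuts_subset_cyc_cuts: "cuts n f \<subseteq> cyc_cuts n p f"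
  by (auto simp: cuts_def cyc_cuts_def cyc_succ_def)

lemma cuts_rcomp: "cuts n (rcomp {1..n} f g) \<subseteq> cuts n f"
  by (auto simp: cuts_def rcomp_def compose_def)

text \<open>The generator is the first factor of the product.\<close>

lemma cuts_semigroup_gen:
  "f \<in> semigroup_gen (rcomp {1..n}) G \<Longrightarrow> \<exists>g\<in>G. cuts n f \<subseteq> cuts n g"
  by (induction rule: semigroup_gen.induct) (use cuts_rcomp in blast)+

lemma card_cyc_cuts_le:
  assumes "p \<in> {1..n}" "turned_mono n p f" "f ` {1..n} \<subseteq> Y" "finite Y"
  shows "card (cyc_cuts n p f) \<le> card Y"
proof -
  have "card (cyc_cuts n p f) = card (f ` cyc_cuts n p f)"
    using inj_on_cyc_cuts[OF assms(1,2)] by (simp add: card_image)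
  also have "\<dots> \<le> card Y"
    using assms(3,4) by (intro card_mono) (auto simp: cyc_cuts_def)
  finally show ?thesis .
qed

text \<open>A monotone map on a chain has one value more than it has cuts; formally, \<open>n\<close> is a further cyclic cut.\<close>

lemma card_cuts_mono:
  assumes "1 \<le> n" "mono_on {1..n} f" "f ` {1..n} \<subseteq> Y" "finite Y"
  shows "card (cuts n f) < card Y"
proof -
  have "insert n (cuts n f) \<subseteq> cyc_cuts n n f"
    using cuts_subset_cyc_cuts[of n f n] assms(1) by (auto simp: cyc_cuts_def)
  then have "card (insert n (cuts n f)) \<le> card (cyc_cuts n n f)"
    by (intro card_mono) (auto simp: cyc_cuts_def)
  also have "\<dots> \<le> card Y"
    using assms by (intro card_cyc_cuts_le) (auto simp: turned_mono_last)
  finally show ?thesis using finite_cuts[of n f] by (simp add: cuts_def)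
qed

text \<open>If \<open>f\<close> separates \<open>1\<close> from \<open>n\<close>, the gap between \<open>n\<close> and \<open>1\<close> is a further cyclic cut, which leaves room
for fewer than \<open>card Y\<close> cuts elsewhere.\<close>

lemma card_cuts_le:
  assumes "1 \<le> n" "orientation_preserving {1..n} f" "f ` {1..n} \<subseteq> Y" "finite Y"
  shows "card (cuts n f) \<le> card Y"
    and "card (cuts n f) = card Y \<Longrightarrow> f 1 = f n"
proof -
  obtain p where p: "p \<in> {1..n}" "turned_mono n p f"
    using assms orientation_preserving_iff_turned_mono by blast
  have le: "card (cyc_cuts n p f) \<le> card Y"
    using card_cyc_cuts_le[OF p assms(3,4)] .
  have fin: "finite (cyc_cuts n p f)" by (simp add: cyc_cuts_def)
  show "card (cuts n f) \<le> card Y"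
    using card_mono[OF fin cuts_subset_cyc_cuts] le by linarith
  assume eq: "card (cuts n f) = card Y"
  show "f 1 = f n"
  proof (rule ccontr)
    assume "f 1 \<noteq> f n"
    then have "insert n (cuts n f) \<subseteq> cyc_cuts n p f"
      using cuts_subset_cyc_cuts[of n f p] assms(1) by (auto simp: cyc_cuts_def cyc_succ_def)
    from card_mono[OF fin this] have "Suc (card (cuts n f)) \<le> card (cyc_cuts n p f)"
      using finite_cuts[of n f] by (simp add: cuts_def)
    then show False using le eq by simp
  qed
qed

section \<open>The maps of maximal rank\<close>

text \<open>The index of the arc that contains \<open>x\<close> when the circle is cut after each point of \<open>C\<close>, counted from
the arc of \<open>1\<close>. If \<open>n \<notin> C\<close>, the indices \<open>0\<close> and \<open>card C\<close> belong to the same arc, so indices are to be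
read modulo \<open>card C\<close>.\<close>

definition block :: "nat set \<Rightarrow> nat \<Rightarrow> nat" where
  "block C x = card {c\<in>C. c < x}"

lemma block_le: "finite C \<Longrightarrow> block C x \<le> card C"
  unfolding block_def by (intro card_mono) auto

lemma block_mono: "finite C \<Longrightarrow> x \<le> y \<Longrightarrow> block C x \<le> block C y"
  unfolding block_def by (intro card_mono) auto

lemma block_Suc: "finite C \<Longrightarrow> block C (Suc x) = block C x + (if x \<in> C then 1 else 0)"
proof -
  assume fin: "finite C"
  have "{c\<in>C. c < Suc x} = {c\<in>C. c < x} \<union> (if x \<in> C then {x} else {})"
    by (auto simp: less_Suc_eq)
  then show ?thesis using fin by (auto simp: block_def)
qed

text \<open>Counting arcs from a cut \<open>p\<close> instead of from \<open>1\<close> amounts to a cyclic shift of the index. This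
expresses the shift that makes an arc map monotone in the chain that starts after \<open>p\<close>.\<close>

lemma block_turn:
  assumes C: "C \<subseteq> {1..n}" and p: "p \<in> C" and x: "x \<in> {1..n}"
  shows "(block C x + (card C - block C (Suc p))) mod card C = card {c\<in>C. pos n p c < pos n p x}"
    (is "_ = card ?L")
proof -
  have fin: "finite C" using C finite_subset by blast
  let ?q = "block C (Suc p)"
  have q: "?q \<le> card C" "0 < ?q"
    using block_le[OF fin, of "Suc p"] p block_Suc[OF fin, of p] by simp_all
  have "p \<in> {1..n}" using p C by blast
  then have "p \<notin> ?L" using pos_le_last[OF _ x] by (simp add: not_less)
  then have sub: "?L \<subset> C" using p by blast
  then have lt: "card ?L < card C" using fin by (simp add: psubset_card_mono)
  show ?thesis
  proof (cases "p < x")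
    case True
    have "{c\<in>C. c < x} = ?L \<union> {c\<in>C. c < Suc p}"
      using True C x by (auto simp: pos_def split: if_splits)
    moreover have "?L \<inter> {c\<in>C. c < Suc p} = {}"
      using True C x by (auto simp: pos_def)
    ultimately have "block C x = card ?L + ?q"
      using fin by (simp add: block_def card_Un_disjoint)
    then show ?thesis using lt q by simp
  next
    case False
    have "?L = (C - {c\<in>C. c < Suc p}) \<union> {c\<in>C. c < x}"
      using False C x by (auto simp: pos_def split: if_splits)
    moreover have "(C - {c\<in>C. c < Suc p}) \<inter> {c\<in>C. c < x} = {}" using False by auto
    ultimately have "card ?L = card (C - {c\<in>C. c < Suc p}) + block C x"
      using fin by (simp add: block_def card_Un_disjoint)
    also have "card (C - {c\<in>C. c < Suc p}) = card C - ?q"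
      unfolding block_def using fin by (intro card_Diff_subset) auto
    finally show ?thesis using lt by simp
  qed
qed

locale range_in_chain =
  fixes n m :: nat and X Y :: "nat set"
  assumes X: "X = {1..n}" and Y: "Y \<subseteq> X" and m: "card Y = m" and m2: "1 < m"
begin

abbreviation "OPXY \<equiv> orient_pres_trans X Y"
abbreviation "OXY \<equiv> order_pres_trans X Y"

definition a :: "nat \<Rightarrow> nat" where "a i = sorted_list_of_set Y ! i"

definition arc_map :: "nat set \<Rightarrow> nat \<Rightarrow> nat \<Rightarrow> nat" where
  "arc_map C s = (\<lambda>x\<in>X. a ((block C x + s) mod m))"

lemma finY: "finite Y" using X Y finite_subset by blast

lemma mn: "m \<le> n" "1 \<le> n"
  using card_mono[OF _ Y] X m m2 by auto

lemma a_less: "i < j \<Longrightarrow> j < m \<Longrightarrow> a i < a j"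
  unfolding a_def
  using strict_sorted_list_of_set[of Y] m by (auto simp: sorted_wrt_iff_nth_less)

lemma a_le: "i \<le> j \<Longrightarrow> j < m \<Longrightarrow> a i \<le> a j"
  using a_less[of i j] by (cases "i = j") auto

lemma a_inj: "i < m \<Longrightarrow> j < m \<Longrightarrow> a i = a j \<longleftrightarrow> i = j"
  by (metis a_less linorder_neqE_nat order_less_irrefl)

lemma a_image: "a ` {..<m} = Y"
proof -
  have "a ` {..<m} = set (sorted_list_of_set Y)"
    using m by (auto simp: a_def set_conv_nth image_def)
  then show ?thesis using finY by simp
qed

lemma a_in: "i < m \<Longrightarrow> a i \<in> Y"
  using a_image by blast

lemma Y_below_a: "i < m \<Longrightarrow> {c\<in>Y. c < a i} = a ` {..<i}"
proof -
  assume i: "i < m"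
  have "a k < a i \<longleftrightarrow> k < i" if "k < m" for k
    by (metis a_less i linorder_neqE_nat order_less_asym that order_less_irrefl)
  then have "{c\<in>a ` {..<m}. c < a i} = a ` {..<i}" using i by auto
  then show ?thesis by (simp add: a_image)
qed

lemma block_Y: "i < m \<Longrightarrow> block Y (a i) = i"
  unfolding block_def using Y_below_a[of i]
  by (simp add: card_image inj_on_def a_inj)

lemma trans_into_iff: "f \<in> trans_into X Y \<longleftrightarrow> f \<in> extensional X \<and> f ` X \<subseteq> Y"
  using Y unfolding trans_into_def full_trans_def PiE_iff by blast

lemma OP_iff:
  "f \<in> OPXY \<longleftrightarrow> f \<in> extensional X \<and> f ` X \<subseteq> Y \<and> (\<exists>p\<in>{1..n}. turned_mono n p f)"
  using orientation_preserving_iff_turned_mono[OF mn(2), of f]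
  unfolding orient_pres_trans_def mem_Collect_eq trans_into_iff by (simp add: X)

lemma OP_D:
  assumes "f \<in> OPXY"
  shows "f \<in> extensional X" "f ` X \<subseteq> Y" "\<exists>p\<in>{1..n}. turned_mono n p f"
  using assms unfolding OP_iff by simp_all

lemma OP_I:
  "f \<in> extensional X \<Longrightarrow> f ` X \<subseteq> Y \<Longrightarrow> p \<in> {1..n} \<Longrightarrow> turned_mono n p f \<Longrightarrow> f \<in> OPXY"
  unfolding OP_iff by blast

lemma O_iff: "f \<in> OXY \<longleftrightarrow> f \<in> extensional X \<and> f ` X \<subseteq> Y \<and> mono_on X f"
  unfolding order_pres_trans_def mem_Collect_eq trans_into_iff by simp

lemma O_subset_OP: "OXY \<subseteq> OPXY"
proof
  fix f assume f: "f \<in> OXY"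
  then have "turned_mono n n f" unfolding O_iff turned_mono_last X[symmetric] by blast
  then show "f \<in> OPXY" using f mn(2) OP_I[of f n] by (simp add: O_iff)
qed

lemma rcomp_apply: "x \<in> X \<Longrightarrow> rcomp X f g x = g (f x)"
  by (simp add: rcomp_def compose_def)

lemma rcomp_extensional: "rcomp X f g \<in> extensional X"
  by (simp add: rcomp_def compose_def)

lemma rcomp_OP: "f \<in> OPXY \<Longrightarrow> g \<in> OPXY \<Longrightarrow> rcomp X f g \<in> OPXY"
proof -
  assume f: "f \<in> OPXY" and g: "g \<in> OPXY"
  obtain p q where "p \<in> {1..n}" "turned_mono n p f" "q \<in> {1..n}" "turned_mono n q g"
    using OP_D(3)[OF f] OP_D(3)[OF g] by blast
  moreover have fX: "f ` X \<subseteq> X" using OP_D(2)[OF f] Y by blast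
  ultimately obtain r where r: "r \<in> {1..n}" "turned_mono n r (\<lambda>x. g (f x))"
    using turned_mono_comp[of p n q f g] X by blast
  then have "turned_mono n r (rcomp X f g)"
    unfolding turned_mono_def X[symmetric] by (simp add: rcomp_apply)
  moreover have "rcomp X f g ` X \<subseteq> Y"
    using fX OP_D(2)[OF g] by (force simp: rcomp_apply)
  ultimately show ?thesis using OP_I[OF rcomp_extensional _ r(1)] by blast
qed

lemma rcomp_O: "f \<in> OXY \<Longrightarrow> g \<in> OXY \<Longrightarrow> rcomp X f g \<in> OXY"
proof -
  assume f: "f \<in> OXY" and g: "g \<in> OXY"
  have fX: "f x \<in> X" if "x \<in> X" for x
    using f Y that unfolding O_iff by blast
  have "mono_on X (rcomp X f g)"
    using f g fX by (auto simp: O_iff mono_on_def rcomp_apply)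
  moreover have "rcomp X f g ` X \<subseteq> Y"
    using fX g by (force simp: O_iff rcomp_apply)
  ultimately show ?thesis using rcomp_extensional unfolding O_iff by blast
qed

lemma gen_subset_OP: "G \<subseteq> OPXY \<Longrightarrow> semigroup_gen (rcomp X) G \<subseteq> OPXY"
proof
  fix f assume "G \<subseteq> OPXY" "f \<in> semigroup_gen (rcomp X) G"
  from this(2,1) show "f \<in> OPXY"
    by (induction rule: semigroup_gen.induct) (auto intro: rcomp_OP)
qed

text \<open>The shifted index \<open>block C x + s mod m\<close> stays below \<open>2 * m\<close>, so it wraps around at most once. The
chain is split where it wraps.\<close>

lemma arc_map_in_OP:
  assumes C: "C \<subseteq> X" "card C = m"
  shows "arc_map C s \<in> OPXY"
proof -
  have fin: "finite C" using C(1) X finite_subset by blast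
  define t where "t = s mod m"
  have t: "t < m" using m2 by (simp add: t_def)
  have eq: "arc_map C s x = a ((block C x + t) mod m)" if "x \<in> X" for x
    using that by (simp add: arc_map_def t_def mod_add_right_eq)
  have b: "block C x \<le> m" for x using block_le[OF fin] C(2) by simp
  have b1: "block C 1 = 0" using C(1) X by (auto simp: block_def)
  define P where "P = {x\<in>X. block C x + t < m}"
  have finP: "finite P" by (simp add: P_def X)
  have "1 \<in> P" using b1 t mn(2) by (simp add: P_def X)
  then have pP: "Max P \<in> P" using Max_in[OF finP] by blast
  define p where "p = Max P"
  have mem: "block C x + t < m \<longleftrightarrow> x \<le> p" if "x \<in> X" for x
  proof
    assume "block C x + t < m"
    then show "x \<le> p" using that finP by (simp add: p_def P_def)
  next
    assume "x \<le> p"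
    then have "block C x \<le> block C p" using block_mono[OF fin] by blast
    then show "block C x + t < m" using pP by (simp add: p_def P_def)
  qed
  have val: "(block C x + t) mod m = (if x \<le> p then block C x + t else block C x + t - m)"
    if "x \<in> X" for x
    using mem[OF that] b[of x] t by (auto simp: mod_if)
  have "turned_mono n p (arc_map C s)"
    unfolding turned_mono_def
  proof (intro ballI impI)
    fix x y assume xy: "x \<in> {1..n}" "y \<in> {1..n}" and le: "pos n p x \<le> pos n p y"
    have xyX: "x \<in> X" "y \<in> X" using xy X by auto
    consider "x \<le> y" "x \<le> p \<longleftrightarrow> y \<le> p" | "p < x" "y \<le> p"
      using le xy by (auto simp: pos_def split: if_splits)
    then have "(block C x + t) mod m \<le> (block C y + t) mod m"
    proof cases
      case 1
      then show ?thesis using block_mono[OF fin 1(1)] by (simp add: val xyX diff_le_mono)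
    next
      case 2
      then show ?thesis using b[of x] by (simp add: val xyX)
    qed
    then show "arc_map C s x \<le> arc_map C s y"
      using m2 by (simp add: eq xyX a_le)
  qed
  moreover have "p \<in> {1..n}" using pP by (simp add: p_def P_def X)
  moreover have "arc_map C s ` X \<subseteq> Y" using a_in m2 by (auto simp: arc_map_def)
  moreover have "arc_map C s \<in> extensional X" by (simp add: arc_map_def)
  ultimately show ?thesis by (intro OP_I)
qed

text \<open>With a cut at \<open>n\<close> the index of the last arc is \<open>m - 1\<close>, so unshifted indices never wrap around.\<close>

lemma arc_map_in_O:
  assumes C: "C \<subseteq> X" "card C = m" "n \<in> C"
  shows "arc_map C 0 \<in> OXY"
proof -
  have fin: "finite C" using C(1) X finite_subset by blast
  have b: "block C x < m" if "x \<in> X" for x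
  proof -
    have "n \<notin> {c\<in>C. c < x}" using that X by auto
    then have "{c\<in>C. c < x} \<subset> C" using C(3) by blast
    then show ?thesis using fin C(2) psubset_card_mono by (auto simp: block_def)
  qed
  have "mono_on X (arc_map C 0)"
    using b block_mono[OF fin] by (auto simp: mono_on_def arc_map_def intro!: a_le)
  moreover have "arc_map C 0 ` X \<subseteq> Y" using a_in m2 by (auto simp: arc_map_def)
  ultimately show ?thesis by (auto simp: O_iff arc_map_def)
qed

text \<open>Extend the cuts of \<open>f\<close> to a set \<open>C\<close> of \<open>m\<close> cuts and take the arc map \<open>\<gamma>\<close> that increases along the same
rotated chain as \<open>f\<close>. Since \<open>\<gamma>\<close> is constant only where \<open>f\<close> is, and both increase along the same chain,
\<open>f x\<close> is a monotone function of \<open>\<gamma> x\<close>, which extends to an order-preserving map \<open>d\<close> on \<open>X\<close>. No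
rotation is left over for the second factor.\<close>

lemma OP_factor:
  assumes f: "f \<in> OPXY"
  shows "\<exists>C s d. C \<subseteq> X \<and> card C = m \<and> d \<in> OXY \<and> f = rcomp X (arc_map C s) d"
proof -
  obtain p where p: "p \<in> {1..n}" and tm: "turned_mono n p f"
    and ext: "f \<in> extensional X" and im: "f ` X \<subseteq> Y"
    using OP_D[OF f] by blast
  have "card (cyc_cuts n p f) \<le> m"
    using card_cyc_cuts_le[OF p tm _ finY] im X m by simp
  moreover have "cyc_cuts n p f \<subseteq> X" by (auto simp: cyc_cuts_def X)
  ultimately obtain C where C: "cyc_cuts n p f \<subseteq> C" "C \<subseteq> X" "card C = m"
    using exists_subset_between[of "cyc_cuts n p f" m X] mn X by auto
  have pC: "p \<in> C" using C(1) p by (auto simp: cyc_cuts_def)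
  have finC: "finite C" using C(2) X finite_subset by blast
  define s where "s = m - block C (Suc p)"
  define g where "g x = card {c\<in>C. pos n p c < pos n p x}" for x
  have arc: "arc_map C s x = a (g x)" and gm: "g x < m" if "x \<in> X" for x
  proof -
    have *: "(block C x + s) mod m = g x"
      using block_turn[of C n p x] C pC that X by (simp add: s_def g_def)
    then show "arc_map C s x = a (g x)" using that by (simp add: arc_map_def)
    show "g x < m" unfolding *[symmetric] using m2 by simp
  qed
  have key: "f x \<le> f z" if x: "x \<in> X" and z: "z \<in> X" and le: "arc_map C s x \<le> arc_map C s z" for x z
  proof (rule ccontr)
    assume "\<not> f x \<le> f z"
    then have "f z < f x" by simp
    then obtain c where c: "c \<in> cyc_cuts n p f" "pos n p z \<le> pos n p c" "pos n p c < pos n p x"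
      using cut_between[OF p tm] x z X by blast
    have "{c\<in>C. pos n p c < pos n p z} \<subset> {c\<in>C. pos n p c < pos n p x}"
    proof (rule psubsetI)
      have "c \<in> {c\<in>C. pos n p c < pos n p x}" "c \<notin> {c\<in>C. pos n p c < pos n p z}"
        using c C(1) by auto
      then show "{c\<in>C. pos n p c < pos n p z} \<noteq> {c\<in>C. pos n p c < pos n p x}" by blast
    qed (use c in auto)
    then have "g z < g x" unfolding g_def using finC by (intro psubset_card_mono) auto
    then have "a (g z) < a (g x)" using a_less[OF _ gm[OF x]] by blast
    then show False using le by (simp add: arc x z)
  qed
  \<comment> \<open>The start of the rotated chain, where \<open>f\<close> is minimal.\<close>
  define b where "b = cyc_succ n p"
  have bX: "b \<in> X" using cyc_succ_in[OF p] by (simp add: b_def X)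
  have b_min: "f b \<le> f x" if "x \<in> X" for x
  proof -
    have "pos n p b \<le> pos n p x"
      using that p X by (auto simp: b_def cyc_succ_def pos_def)
    then show ?thesis using turned_monoD[OF tm] that bX X by blast
  qed
  \<comment> \<open>The value \<open>f b\<close> only matters for \<open>y\<close> below the image of the arc map, where it is the default.\<close>
  define S where "S y = insert (f b) (f ` {x\<in>X. arc_map C s x \<le> y})" for y
  define d where "d = (\<lambda>y\<in>X. Max (S y))"
  have finS: "finite (S y)" for y by (simp add: S_def X)
  have SY: "S y \<subseteq> Y" for y using im bX by (auto simp: S_def)
  have "d ` X \<subseteq> Y"
  proof -
    have "Max (S y) \<in> S y" for y using finS by (intro Max_in) (auto simp: S_def)
    then show ?thesis using SY by (auto simp: d_def)
  qed
  moreover have "mono_on X d"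
    unfolding mono_on_def
  proof (intro allI impI)
    fix y z assume yz: "y \<in> X \<and> z \<in> X \<and> y \<le> z"
    then have "S y \<subseteq> S z" by (auto simp: S_def)
    then have "Max (S y) \<le> Max (S z)" using finS by (intro Max_mono) (auto simp: S_def)
    then show "d y \<le> d z" using yz by (simp add: d_def)
  qed
  ultimately have dO: "d \<in> OXY" by (auto simp: O_iff d_def)
  have "f = rcomp X (arc_map C s) d"
  proof (rule extensionalityI[OF ext rcomp_extensional])
    fix z assume z: "z \<in> X"
    have "arc_map C s z \<in> X" using arc[OF z] a_in[OF gm[OF z]] Y by auto
    then have "d (arc_map C s z) = Max (S (arc_map C s z))" by (simp add: d_def)
    also have "\<dots> = f z"
      using finS key[OF _ z] b_min[OF z] z by (intro Max_eqI) (auto simp: S_def)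
    finally show "f z = rcomp X (arc_map C s) d z" using z by (simp add: rcomp_apply)
  qed
  then show ?thesis using C dO by blast
qed

section \<open>The upper bound\<close>

definition cut_sets :: "nat set set" where
  "cut_sets = {C. C \<subseteq> {1..<n} \<and> card C = m}"

lemma card_cut_sets: "card cut_sets = (n - 1) choose m"
  unfolding cut_sets_def using n_subsets[of "{1..<n}" m] by simp

lemma finite_cut_sets: "finite cut_sets"
  unfolding cut_sets_def by (rule finite_subset[of _ "Pow {1..<n}"]) auto

lemma cut_sets_subset: "C \<in> cut_sets \<Longrightarrow> C \<subseteq> X \<and> card C = m"
  by (auto simp: cut_sets_def X)

text \<open>The cuts \<open>R\<close> are meant to yield the rotation of \<open>Y\<close>. One common shift \<open>t\<close> for all generators is
enough, because the rotation changes the shift.\<close>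

definition gens :: "nat set \<Rightarrow> nat \<Rightarrow> (nat \<Rightarrow> nat) set" where
  "gens R t = (\<lambda>C. arc_map C t) ` insert R cut_sets"

text \<open>Composing with the rotation raises the shift by one, and shifts count modulo \<open>m\<close>. So a single map
for each set of cuts yields all its shifts: it is a generator if \<open>n \<notin> C\<close> and order-preserving if
\<open>n \<in> C\<close>. The factorization of \<open>OP_factor\<close> then reaches everything else.\<close>

lemma gens_generate:
  assumes R: "R \<subseteq> X" "card R = m"
    and rot: "\<And>i. i < m \<Longrightarrow> arc_map R t (a i) = a (Suc i mod m)"
  shows "gens R t \<subseteq> OPXY" and "semigroup_gen (rcomp X) (OXY \<union> gens R t) = OPXY"
proof -
  let ?S = "semigroup_gen (rcomp X) (OXY \<union> gens R t)"
  show sub: "gens R t \<subseteq> OPXY"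
  proof -
    have "arc_map C t \<in> OPXY" if "C \<in> insert R cut_sets" for C
      using that R arc_map_in_OP cut_sets_subset by blast
    then show ?thesis unfolding gens_def by blast
  qed
  have rotR: "arc_map R t \<in> ?S"
    by (intro semigroup_gen.base) (auto simp: gens_def)
  have step: "rcomp X (arc_map C s) (arc_map R t) = arc_map C (Suc s)" for C s
  proof (rule extensionalityI[OF rcomp_extensional])
    fix x assume x: "x \<in> X"
    then show "rcomp X (arc_map C s) (arc_map R t) x = arc_map C (Suc s) x"
      using m2 rot[of "(block C x + s) mod m"]
      by (simp add: rcomp_apply arc_map_def[of C] mod_Suc_eq)
  qed (simp add: arc_map_def)
  have turn: "arc_map C (s + k) \<in> ?S" if "arc_map C s \<in> ?S" for C s k
  proof (induction k)
    case (Suc k)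
    then show ?case using semigroup_gen.mult[OF Suc rotR] step by simp
  qed (use that in simp)
  have arcs: "arc_map C s \<in> ?S" if C: "C \<subseteq> X" "card C = m" for C s
  proof -
    have "\<exists>u. arc_map C u \<in> ?S"
    proof (cases "n \<in> C")
      case True
      then show ?thesis using arc_map_in_O C by (blast intro: semigroup_gen.base)
    next
      case False
      have "x \<in> {1..<n}" if "x \<in> C" for x
      proof -
        have "x \<noteq> n" using that False by blast
        moreover have "x \<in> {1..n}" using that C X by blast
        ultimately show ?thesis by simp
      qed
      then have "C \<in> cut_sets" using C by (auto simp: cut_sets_def)
      then have "arc_map C t \<in> ?S" by (intro semigroup_gen.base) (auto simp: gens_def)
      then show ?thesis by blast
    qed
    then obtain u where "arc_map C u \<in> ?S" by blast
    \<comment> \<open>Raising the shift \<open>u\<close> by \<open>(m - 1) * u + s\<close> gives \<open>m * u + s\<close>, which is \<open>s\<close> modulo \<open>m\<close>.\<close>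
    from turn[OF this, of "(m - 1) * u + s"]
    have "arc_map C (u + ((m - 1) * u + s)) \<in> ?S" .
    moreover have "u + ((m - 1) * u + s) = m * u + s"
      using m2 by (cases m) auto
    moreover have "arc_map C (m * u + s) = arc_map C s"
    proof -
      have "(block C x + (m * u + s)) mod m = (block C x + s) mod m" for x
        by (metis add.left_commute mod_mult_self4)
      then show ?thesis by (simp add: arc_map_def)
    qed
    ultimately show ?thesis by metis
  qed
  show "?S = OPXY"
  proof
    show "?S \<subseteq> OPXY" using gen_subset_OP sub O_subset_OP by blast
    show "OPXY \<subseteq> ?S"
    proof
      fix f assume "f \<in> OPXY"
      then obtain C s d where C: "C \<subseteq> X" "card C = m" and d: "d \<in> OXY"
        and f: "f = rcomp X (arc_map C s) d"
        using OP_factor by blast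
      have "d \<in> ?S" using d by (blast intro: semigroup_gen.base)
      then show "f \<in> ?S" unfolding f by (rule semigroup_gen.mult[OF arcs[OF C]])
    qed
  qed
qed

text \<open>Cutting after each point of \<open>Y\<close> puts \<open>a i\<close> into the arc with index \<open>i\<close>, so shift \<open>1\<close> rotates \<open>Y\<close>.\<close>

lemma rotation_from_Y: "i < m \<Longrightarrow> arc_map Y 1 (a i) = a (Suc i mod m)"
  using a_in[of i] Y block_Y[of i] by (auto simp: arc_map_def)

text \<open>Cutting before each point of \<open>Y\<close> instead puts \<open>a i\<close> into the arc with index \<open>i + 1\<close>, which is already
the rotation without a shift. As \<open>1 \<notin> Y\<close>, all these cuts lie in \<open>{1..<n}\<close>.\<close>

lemma rotation_from_predecessors:
  assumes "1 \<notin> Y"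
  defines "R \<equiv> (\<lambda>y. y - 1) ` Y"
  shows "R \<subseteq> {1..<n}" "card R = m" "\<And>i. i < m \<Longrightarrow> arc_map R 0 (a i) = a (Suc i mod m)"
proof -
  have ge: "2 \<le> y" "y \<le> n" if "y \<in> Y" for y
  proof -
    have "y \<in> {1..n}" "y \<noteq> 1" using that Y X assms(1) by auto
    then show "2 \<le> y" "y \<le> n" by auto
  qed
  show "R \<subseteq> {1..<n}" using ge by (force simp: R_def)
  have inj: "inj_on (\<lambda>y. y - 1) Y"
  proof (rule inj_onI)
    fix x y assume "x \<in> Y" "y \<in> Y" "x - 1 = y - 1"
    then show "x = y" using ge(1)[of x] ge(1)[of y] by linarith
  qed
  show "card R = m" using card_image[OF inj] m by (simp add: R_def)
  fix i assume i: "i < m"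
  have "{c\<in>R. c < a i} = (\<lambda>y. y - 1) ` {y\<in>Y. y < Suc (a i)}"
    using ge by (force simp: R_def)
  moreover have "inj_on (\<lambda>y. y - 1) {y\<in>Y. y < Suc (a i)}"
    using inj by (rule inj_on_subset) auto
  ultimately have "block R (a i) = block Y (Suc (a i))"
    by (simp add: block_def card_image)
  also have "\<dots> = Suc i"
    using block_Suc[OF finY] block_Y[OF i] a_in[OF i] by simp
  finally show "arc_map R 0 (a i) = a (Suc i mod m)"
    using a_in[OF i] Y by (auto simp: arc_map_def)
qed

lemma relative_rank_le:
  assumes "R \<subseteq> X" "card R = m" "\<And>i. i < m \<Longrightarrow> arc_map R t (a i) = a (Suc i mod m)"
  shows "relative_rank (rcomp X) OPXY OXY \<le> enat (card (insert R cut_sets))"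
proof -
  have fin: "finite (gens R t)" using finite_cut_sets by (simp add: gens_def)
  have "relative_rank (rcomp X) OPXY OXY \<le> enat (card (gens R t))"
    unfolding relative_rank_def
    by (rule INF_lower) (use gens_generate[OF assms] fin in auto)
  also have "card (gens R t) \<le> card (insert R cut_sets)"
    unfolding gens_def using finite_cut_sets by (intro card_image_le) simp
  finally show ?thesis by simp
qed

section \<open>The lower bound\<close>

text \<open>The product \<open>arc_map C 0\<close> has all its \<open>m\<close> cuts from its first factor. That factor can have no further
cuts, and it has too many to be order-preserving.\<close>

lemma cut_sets_covered:
  assumes "B \<subseteq> OPXY" "semigroup_gen (rcomp X) (OXY \<union> B) = OPXY"
  shows "cut_sets \<subseteq> cuts n ` {b\<in>B. card (cuts n b) = m}"
proof
  fix C assume "C \<in> cut_sets"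
  then have C: "C \<subseteq> {1..<n}" "card C = m" by (auto simp: cut_sets_def)
  have fin: "finite C" using C(1) finite_subset by blast
  have "C \<subseteq> X" using C(1) by (auto simp: X)
  then have arc: "arc_map C 0 \<in> semigroup_gen (rcomp X) (OXY \<union> B)"
    using arc_map_in_OP C assms(2) by blast
  then obtain b where b: "b \<in> OXY \<union> B" "cuts n (arc_map C 0) \<subseteq> cuts n b"
    using cuts_semigroup_gen X by blast
  have "C \<subseteq> cuts n (arc_map C 0)"
  proof
    fix x assume x: "x \<in> C"
    then have xn: "x \<in> {1..<n}" using C by blast
    then have xX: "x \<in> X" "Suc x \<in> X" by (auto simp: X)
    have "block C x mod m \<noteq> Suc (block C x) mod m"
      using m2 by (simp add: mod_Suc)
    then have "a (block C x mod m) \<noteq> a (block C (Suc x) mod m)"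
      using m2 x block_Suc[OF fin, of x] by (simp add: a_inj)
    then show "x \<in> cuts n (arc_map C 0)"
      using xn xX by (simp add: cuts_def arc_map_def)
  qed
  then have sub: "C \<subseteq> cuts n b" using b by blast
  have bOP: "b \<in> OPXY" using b assms O_subset_OP by blast
  have ori: "orientation_preserving {1..n} b" "b ` {1..n} \<subseteq> Y"
    using bOP X by (auto simp: orient_pres_trans_def trans_into_def)
  have "card (cuts n b) \<le> m" using card_cuts_le(1)[OF mn(2) ori finY] m by simp
  then have eq: "C = cuts n b"
    using card_seteq[OF finite_cuts sub] C by simp
  have "b \<notin> OXY"
  proof
    assume "b \<in> OXY"
    then have "mono_on {1..n} b" unfolding O_iff X[symmetric] by blast
    then have "card (cuts n b) < m"
      using card_cuts_mono[OF mn(2) _ ori(2) finY] m by simp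
    then show False using eq C by simp
  qed
  then show "C \<in> cuts n ` {b\<in>B. card (cuts n b) = m}" using b eq C by blast
qed

lemma card_generators_ge:
  assumes "B \<subseteq> OPXY" "finite B" "semigroup_gen (rcomp X) (OXY \<union> B) = OPXY"
  shows "(n - 1) choose m \<le> card {b\<in>B. card (cuts n b) = m}"
  using surj_card_le[OF _ cut_sets_covered[OF assms(1,3)]] assms(2) card_cut_sets by simp

text \<open>An invariant of products of order-preserving maps and generators with \<open>m\<close> cuts. Such generators
identify \<open>1\<close> and \<open>n\<close>. In the only nontrivial case of a product \<open>f g\<close>, the factor \<open>f\<close> is
order-preserving onto \<open>Y\<close>; then a factor \<open>g\<close> that identifies the points \<open>1, n\<close> of \<open>Y\<close> lowers the rank.\<close>

lemma generated_by_full_cuts: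
  assumes ends: "{1, n} \<subseteq> Y"
    and B: "B \<subseteq> OPXY" "\<And>b. b \<in> B \<Longrightarrow> card (cuts n b) = m"
    and f: "f \<in> semigroup_gen (rcomp X) (OXY \<union> B)"
  shows "f \<in> OXY \<or> f 1 = f n \<or> card (f ` X) < m"
  using f
proof (induction rule: semigroup_gen.induct)
  case (base g)
  show ?case
  proof (cases "g \<in> OXY")
    case False
    then have g: "g \<in> B" using base by blast
    then have "g \<in> OPXY" using B by blast
    then have "orientation_preserving {1..n} g" "g ` {1..n} \<subseteq> Y"
      using X by (auto simp: orient_pres_trans_def trans_into_def)
    from card_cuts_le(2)[OF mn(2) this finY] show ?thesis using B(2)[OF g] m by simp
  qed simp
next
  case (mult f g)
  have OPs: "f \<in> OPXY" "g \<in> OPXY"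
    using mult.hyps gen_subset_OP[of "OXY \<union> B"] O_subset_OP B(1) by blast+
  have fY: "f ` X \<subseteq> Y" using OP_D(2)[OF OPs(1)] .
  have img: "rcomp X f g ` X = g ` f ` X" by (force simp: rcomp_apply)
  have finX: "finite X" by (simp add: X)
  have ends_X: "1 \<in> X" "n \<in> X" using ends Y by auto
  consider "f 1 = f n" | "card (f ` X) < m" | "f \<in> OXY" "f ` X = Y"
  proof (cases "f ` X = Y")
    case False
    then have "card (f ` X) < m" using fY finY m psubset_card_mono by blast
    then show ?thesis using that by blast
  qed (use mult.IH that in \<open>auto simp: m\<close>)
  then show ?case
  proof cases
    case 1
    then have "rcomp X f g 1 = rcomp X f g n"
      by (simp only: rcomp_apply ends_X)
    then show ?thesis by blast
  next
    case 2
    then have "card (g ` f ` X) < m" using card_image_le[of "f ` X" g] finX by simp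
    then show ?thesis by (simp add: img)
  next
    case 3
    from mult.IH(2) consider "g \<in> OXY" | "g 1 = g n" | "card (g ` X) < m" by blast
    then show ?thesis
    proof cases
      case 1
      then show ?thesis using 3 rcomp_O by blast
    next
      case 2
      have "1 \<noteq> n" using mn m2 by simp
      then have "\<not> inj_on g Y" using 2 ends by (auto simp: inj_on_def)
      then have "card (g ` Y) < m"
        using card_image_le[OF finY, of g] eq_card_imp_inj_on[OF finY, of g] m by linarith
      then show ?thesis by (simp add: img 3)
    next
      case 3
      have "g ` f ` X \<subseteq> g ` X" using fY Y by blast
      then have "card (g ` f ` X) < m"
        using 3 finX card_mono[of "g ` X" "g ` f ` X"] by simp
      then show ?thesis by (simp add: img)
    qed
  qed
qed

text \<open>The rotation \<open>arc_map Y 1\<close> violates the invariant of \<open>generated_by_full_cuts\<close>: it sends \<open>1\<close> to \<open>a 1\<close>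
and \<open>n\<close> to \<open>a 0\<close>, and its image is \<open>Y\<close>.\<close>

lemma exists_generator_few_cuts:
  assumes ends: "{1, n} \<subseteq> Y"
    and B: "B \<subseteq> OPXY" "semigroup_gen (rcomp X) (OXY \<union> B) = OPXY"
  shows "\<exists>b\<in>B. card (cuts n b) \<noteq> m"
proof (rule ccontr)
  assume "\<not> ?thesis"
  moreover have "arc_map Y 1 \<in> semigroup_gen (rcomp X) (OXY \<union> B)"
    using B(2) arc_map_in_OP[OF Y m] by simp
  ultimately have *: "arc_map Y 1 \<in> OXY \<or> arc_map Y 1 1 = arc_map Y 1 n \<or> card (arc_map Y 1 ` X) < m"
    using generated_by_full_cuts[OF ends B(1)] by blast
  have X1n: "1 \<in> X" "n \<in> X" using ends Y by auto
  have "block Y 1 = 0" using Y X by (auto simp: block_def)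
  then have v1: "arc_map Y 1 1 = a 1" using X1n m2 by (simp add: arc_map_def)
  have "block Y n = m - 1"
  proof -
    have "{c\<in>Y. c < n} = Y - {n}" using Y X by auto
    then show ?thesis using ends finY m by (simp add: block_def)
  qed
  then have vn: "arc_map Y 1 n = a 0" using X1n m2 by (simp add: arc_map_def)
  have less: "a 0 < a 1" using a_less m2 by simp
  have "arc_map Y 1 \<notin> OXY"
  proof
    assume "arc_map Y 1 \<in> OXY"
    then have "arc_map Y 1 1 \<le> arc_map Y 1 n"
      using X1n mn by (auto simp: O_iff mono_on_def)
    then show False using v1 vn less by simp
  qed
  moreover have "Y \<subseteq> arc_map Y 1 ` X"
  proof
    fix y assume "y \<in> Y"
    then obtain j where j: "j < m" "y = a j" using a_image by blast
    define i where "i = (if j = 0 then m - 1 else j - 1)"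
    have i: "i < m" "Suc i mod m = j" using j m2 by (auto simp: i_def)
    then show "y \<in> arc_map Y 1 ` X"
      using rotation_from_Y[OF i(1)] j a_in[OF i(1)] Y by (auto intro!: image_eqI)
  qed
  then have "m \<le> card (arc_map Y 1 ` X)"
    using card_mono[of "arc_map Y 1 ` X" Y] X m by simp
  ultimately show False using * v1 vn less by simp
qed

end

theorem theorem5:
  fixes m n :: nat and X Y :: "nat set"
  assumes "1 < m" and "m < n"
    and "X = {1..n}"
    and "Y \<subseteq> X" and "card Y = m"
  shows "(1 \<notin> Y \<or> n \<notin> Y \<longrightarrow>
            relative_rank (rcomp X) (orient_pres_trans X Y) (order_pres_trans X Y)
              = enat ((n - 1) choose m)) \<and>
         ({1, n} \<subseteq> Y \<longrightarrow>
            relative_rank (rcomp X) (orient_pres_trans X Y) (order_pres_trans X Y)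
              = enat (1 + ((n - 1) choose m)))"
proof -
  interpret range_in_chain n m X Y
    using assms by unfold_locales auto
  have lower: "enat ((n - 1) choose m) \<le> relative_rank (rcomp X) OPXY OXY"
    unfolding relative_rank_def
  proof (rule INF_greatest)
    fix B assume B: "B \<in> {B. B \<subseteq> OPXY \<and> finite B \<and> semigroup_gen (rcomp X) (OXY \<union> B) = OPXY}"
    have "card {b\<in>B. card (cuts n b) = m} \<le> card B"
      using B by (intro card_mono) auto
    then show "enat ((n - 1) choose m) \<le> enat (card B)"
      using card_generators_ge[of B] B by simp
  qed
  have lower_ends: "enat (1 + ((n - 1) choose m)) \<le> relative_rank (rcomp X) OPXY OXY"
    if ends: "{1, n} \<subseteq> Y"
    unfolding relative_rank_def
  proof (rule INF_greatest)
    fix B assume B: "B \<in> {B. B \<subseteq> OPXY \<and> finite B \<and> semigroup_gen (rcomp X) (OXY \<union> B) = OPXY}"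
    then have "{b\<in>B. card (cuts n b) = m} \<subset> B"
      using exists_generator_few_cuts[OF ends, of B] by blast
    then have "card {b\<in>B. card (cuts n b) = m} < card B"
      using B by (intro psubset_card_mono) auto
    then show "enat (1 + ((n - 1) choose m)) \<le> enat (card B)"
      using card_generators_ge[of B] B by simp
  qed
  have upper: "relative_rank (rcomp X) OPXY OXY \<le> enat ((n - 1) choose m)" if "1 \<notin> Y \<or> n \<notin> Y"
  proof -
    have "\<exists>R\<in>cut_sets. \<exists>t. \<forall>i<m. arc_map R t (a i) = a (Suc i mod m)"
    proof (cases "n \<in> Y")
      case False
      have "y \<in> {1..<n}" if "y \<in> Y" for y
      proof -
        have "y \<in> {1..n}" "y \<noteq> n" using that False Y X by blast+
        then show ?thesis by simp
      qed
      then have "Y \<in> cut_sets" using m by (auto simp: cut_sets_def)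
      then show ?thesis using rotation_from_Y by blast
    next
      case True
      then have "1 \<notin> Y" using that by blast
      from rotation_from_predecessors[OF this] show ?thesis
        unfolding cut_sets_def by blast
    qed
    then obtain R t where R: "R \<in> cut_sets" "\<And>i. i < m \<Longrightarrow> arc_map R t (a i) = a (Suc i mod m)"
      by blast
    then have "R \<subseteq> X" "card R = m" using cut_sets_subset by blast+
    from relative_rank_le[OF this R(2)] show ?thesis
      using R(1) card_cut_sets by (simp add: insert_absorb)
  qed
  have upper_ends: "relative_rank (rcomp X) OPXY OXY \<le> enat (1 + ((n - 1) choose m))"
  proof -
    have "card (insert Y cut_sets) \<le> 1 + ((n - 1) choose m)"
      using card_cut_sets finite_cut_sets by (simp add: card_insert_if)
    then show ?thesis
      using relative_rank_le[OF Y m rotation_from_Y] by (meson enat_ord_simps(1) order_trans)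
  qed
  show ?thesis
    using lower upper lower_ends upper_ends by (blast intro: antisym)
qed

end
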